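(* Let $X$ be a finite-dimensional real normed space and let $f: X\to(-\infty,\infty]$ be an extended-real-valued function with $\bar x\in\mathrm{int}\,\mathrm{dom}\,f$. Then the following are equivalent: (i) $f$ is Hadamard strictly differentiable at $\bar x$. (ii) $f$ is Fréchet strictly differentiable at $\bar x$. (iii) $f$ is locally Lipschitz continuous at $\bar x$ and $\partial f(\bar x)$ is a singleton. Moreover, if $f$ is strictly differentiable on an open set $D$ (i.e., at every point of $D$), then it is continuously differentiable on $D$.
   Context: $X^*$ is the dual of $X$ with pairing $\langle\cdot,\cdot\rangle$; $\mathrm{dom}\,f:=\{x: f(x)<\infty\}$. $f$ is Hadamard strictly differentiable at $\bar x\in\mathrm{int}\,\mathrm{dom}\,f$ if there exists $v\in X^*$ such that $\lim_{x\to\bar x,\,t\to0^+}\frac{f(x+td)-f(x)-t\langle v,d\rangle}{t}=0$, where the convergence is uniform for $d$ in every compact subset of $X$. $f$ is Fréchet strictly differentiable at $\bar x$ if there exists $v^*\in X^*$ with $\lim_{x,y\to\bar x,\,x\neq y}\frac{f(x)-f(y)-\langle v^*,x-y\rangle}{\|x-y\|}=0$. $f$ is locally Lipschitz continuous at $\bar x$ if there exist $\ell\ge0$, $\delta>0$ with $|f(x)-f(w)|\le\ell\|x-w\|$ for all $x,w$ in the closed ball of radius $\delta$ centered at $\bar x$. For $\varepsilon\ge0$ and $x\in\mathrm{dom}\,f$, $\widehat\partial_\varepsilon f(x):=\{x^*\in X^*: \liminf_{u\to x}\frac{f(u)-f(x)-\langle x^*,u-x\rangle}{\|u-x\|}\ge-\varepsilon\}$.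 The limiting (Mordukhovich) subdifferential $\partial f(\bar x)$ is the set of all $x^*\in X^*$ for which there exist sequences $\varepsilon_k\downarrow0$, $x_k\to\bar x$ with $f(x_k)\to f(\bar x)$, and $x_k^*\in\widehat\partial_{\varepsilon_k}f(x_k)$ with $x_k^*\to x^*$ (weak$^*$, which is the norm topology here). *)

theory Defs
  imports "HOL-Analysis.Analysis"
begin

text \<open>
  Functions with values in the extended half-line are modelled as \<open>f :: 'a \<Rightarrow> ereal\<close> that never
  take the value \<open>-\<infinity>\<close>; the dual space is the Banach space \<open>'a \<Rightarrow>\<^sub>L real\<close>. Difference quotients are
  formed in \<open>ereal\<close>. There \<open>\<infinity> - \<infinity> = \<infinity>\<close>, so a quotient or difference that involves a point outside
  the domain is infinite (for \<open>f\<close> as above), and is never close to \<open>0\<close> by convention.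
\<close>

definition effective_domain :: "('a \<Rightarrow> ereal) \<Rightarrow> 'a set" where
  "effective_domain f = {x. f x < \<infinity>}"

text \<open>
  Uniform convergence is spelled out because \<open>ereal\<close> is not a metric space, so that
  \<^const>\<open>uniform_limit\<close> does not apply. The base point \<open>x\<close> may be equal to \<open>xbar\<close>.
\<close>

definition hadamard_strictly_differentiable_at ::
    "('a::real_normed_vector \<Rightarrow> ereal) \<Rightarrow> 'a \<Rightarrow> bool" where
  "hadamard_strictly_differentiable_at f xbar \<longleftrightarrow>
     xbar \<in> interior (effective_domain f) \<and>
     (\<exists>v :: 'a \<Rightarrow>\<^sub>L real. \<forall>K. compact K \<longrightarrow>
        (\<forall>e>0. \<forall>\<^sub>F (x, t) in nhds xbar \<times>\<^sub>F at_right (0::real). \<forall>d\<in>K.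
           \<bar>(f (x + t *\<^sub>R d) - f x - ereal (t * blinfun_apply v d)) / ereal t\<bar> < ereal e))"

text \<open>
  Membership in the interior of the domain only matters in dimension \<open>0\<close>, where the limit is vacuous;
  in positive dimension it follows from the limit.
\<close>

definition frechet_strictly_differentiable_at ::
    "('a::real_normed_vector \<Rightarrow> ereal) \<Rightarrow> 'a \<Rightarrow> bool" where
  "frechet_strictly_differentiable_at f xbar \<longleftrightarrow>
     xbar \<in> interior (effective_domain f) \<and>
     (\<exists>v :: 'a \<Rightarrow>\<^sub>L real.
        ((\<lambda>(x, y). (f x - f y - ereal (blinfun_apply v (x - y))) / ereal (norm (x - y))) \<longlongrightarrow> 0)
          (at (xbar, xbar) within {(x, y). x \<noteq> y}))"

definition locally_lipschitz_at :: "('a::real_normed_vector \<Rightarrow> ereal) \<Rightarrow> 'a \<Rightarrow> bool" where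
  "locally_lipschitz_at f xbar \<longleftrightarrow>
     (\<exists>l\<ge>0. \<exists>\<delta>>0. \<forall>x\<in>cball xbar \<delta>. \<forall>w\<in>cball xbar \<delta>.
        \<bar>f x - f w\<bar> \<le> ereal (l * norm (x - w)))"

definition eps_subdifferential ::
    "real \<Rightarrow> ('a::real_normed_vector \<Rightarrow> ereal) \<Rightarrow> 'a \<Rightarrow> ('a \<Rightarrow>\<^sub>L real) set" where
  "eps_subdifferential \<epsilon> f x =
     {v. x \<in> effective_domain f \<and>
         Liminf (at x)
           (\<lambda>u. (f u - f x - ereal (blinfun_apply v (u - x))) / ereal (norm (u - x))) \<ge> - ereal \<epsilon>}"

text \<open>
  The convergence \<open>xs \<longlonglongrightarrow> v\<close> is in the operator norm of the dual, which in finite dimension is the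
  same as weak-star convergence.
\<close>

definition limiting_subdifferential ::
    "('a::real_normed_vector \<Rightarrow> ereal) \<Rightarrow> 'a \<Rightarrow> ('a \<Rightarrow>\<^sub>L real) set" where
  "limiting_subdifferential f xbar =
     {v. \<exists>(\<epsilon> :: nat \<Rightarrow> real) (x :: nat \<Rightarrow> 'a) (xs :: nat \<Rightarrow> ('a \<Rightarrow>\<^sub>L real)).
         (\<forall>k. 0 \<le> \<epsilon> k) \<and> decseq \<epsilon> \<and> \<epsilon> \<longlonglongrightarrow> 0 \<and>
         x \<longlonglongrightarrow> xbar \<and> (\<lambda>k. f (x k)) \<longlonglongrightarrow> f xbar \<and>
         (\<forall>k. xs k \<in> eps_subdifferential (\<epsilon> k) f (x k)) \<and> xs \<longlonglongrightarrow> v}"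

text \<open>
  Finiteness on \<open>D\<close> is part of the notion; it makes \<^const>\<open>real_of_ereal\<close> faithful on the open set \<open>D\<close>.
\<close>

definition continuously_differentiable_on ::
    "('a::real_normed_vector \<Rightarrow> ereal) \<Rightarrow> 'a set \<Rightarrow> bool" where
  "continuously_differentiable_on f D \<longleftrightarrow>
     (\<forall>x\<in>D. \<bar>f x\<bar> \<noteq> \<infinity>) \<and>
     (\<exists>f' :: 'a \<Rightarrow> ('a \<Rightarrow>\<^sub>L real).
        (\<forall>x\<in>D. ((\<lambda>u. real_of_ereal (f u)) has_derivative blinfun_apply (f' x)) (at x)) \<and>
        continuous_on D f')"

end

theory Submission
  imports Defs
begin

text \<open>
  Near a point in the interior of its domain a proper function \<open>f\<close> is real-valued, and there both
  notions of strict differentiability say the same thing about its real part \<open>F\<close>: for each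
  \<open>e > 0\<close> the function \<open>F - v\<close> is \<open>e\<close>-Lipschitz on some ball about \<open>xbar\<close>
  (\<open>strict_derivative_at\<close>). For the Hadamard notion finite dimension is what makes the set of all
  directions compact, so that one choice of compact set controls every increment.

  If \<open>v\<close> is a strict derivative at \<open>xbar\<close>, then every \<open>\<epsilon>\<close>-subgradient at a nearby point is
  within \<open>\<epsilon> + e\<close> of \<open>v\<close> (\<open>subgradients_near_strict_derivative\<close>). In the limit this leaves \<open>v\<close> as
  the only limiting subgradient. Since a strict derivative at \<open>y\<close> is itself a subgradient at \<open>y\<close>, the
  same estimate makes the derivative continuous in the final claim.

  The substance lies in the converse. Let \<open>F\<close> be Lipschitz near \<open>xbar\<close> with \<open>v\<close> as its only limiting
  subgradient. Subgradients of \<open>F\<close> near \<open>xbar\<close> are bounded by the Lipschitz constant, so by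
  compactness of balls in the dual they converge to \<open>v\<close> as the base point tends to \<open>xbar\<close>.
  Hence \<open>G = F - v\<close> has only subgradients of norm below \<open>\<eta>\<close> near \<open>xbar\<close>, and it has to be shown that
  \<open>G\<close> then has small Lipschitz constant. To this end choose an equivalent norm \<open>N \<ge> norm\<close> that is
  differentiable away from \<open>0\<close>, and minimise \<open>G z + \<eta> * N (z - b) + K * (N (z - b))\<^sup>2\<close> over a ball
  about \<open>b\<close>. At a minimiser \<open>z \<noteq> b\<close> in the interior the negative gradient of the penalty would be a
  subgradient of \<open>G\<close> of norm at least \<open>\<eta>\<close>, and a large \<open>K\<close> excludes the boundary. So \<open>b\<close> is the minimiser,
  which is a one-sided increment bound for \<open>G\<close>
  (\<open>increment_bound_from_subgradient_bound\<close>); exchanging the two points gives the other side.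
\<close>

section \<open>Finite-dimensional normed spaces\<close>

text \<open>
  The constant is the distance from \<open>b\<close> to \<open>S\<close>. It bounds the coefficient of \<open>b\<close> in a vector by the
  norm of that vector, both when a basis vector is added in an induction and for coordinate functionals.
\<close>

lemma closed_subspace_coefficient_bound:
  fixes b :: "'a::real_normed_vector"
  assumes "subspace S" "closed S" "b \<notin> S"
  obtains d where "d > 0" "\<And>c y. y \<in> S \<Longrightarrow> \<bar>c\<bar> * d \<le> norm (c *\<^sub>R b + y)"
proof -
  have "S \<noteq> {}" using assms(1) subspace_0 by blast
  define d where "d = infdist b S"
  have "d > 0"
    unfolding d_def using assms \<open>S \<noteq> {}\<close> by (simp add: infdist_pos_not_in_closed)
  moreover have "\<bar>c\<bar> * d \<le> norm (c *\<^sub>R b + y)" if y: "y \<in> S" for c y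
  proof (cases "c = 0")
    case False
    have "- (y /\<^sub>R c) \<in> S"
      using assms(1) y by (simp add: subspace_neg subspace_scale)
    then have "d \<le> dist b (- (y /\<^sub>R c))"
      unfolding d_def by (rule infdist_le)
    then have "\<bar>c\<bar> * d \<le> norm (c *\<^sub>R (b + y /\<^sub>R c))"
      by (simp add: dist_norm mult_left_mono)
    also have "c *\<^sub>R (b + y /\<^sub>R c) = c *\<^sub>R b + y"
      using False by (simp add: scaleR_add_right)
    finally show ?thesis .
  qed simp
  ultimately show thesis using that by blast
qed

lemma closed_if_bounded_seqs_subconverge:
  fixes S :: "'a::real_normed_vector set"
  assumes "\<And>s M. (\<And>n. s n \<in> S) \<Longrightarrow> (\<And>n. norm (s n) \<le> M) \<Longrightarrow>
             \<exists>l\<in>S. \<exists>r. strict_mono (r :: nat \<Rightarrow> nat) \<and> (s \<circ> r) \<longlonglongrightarrow> l"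
  shows "closed S"
  unfolding closed_sequential_limits
proof (intro allI impI, elim conjE)
  fix x l assume x: "\<forall>n. x n \<in> S" "x \<longlonglongrightarrow> l"
  then obtain M where "\<And>n. norm (x n) \<le> M"
    using convergent_imp_Bseq[of x] by (auto simp: convergent_def Bseq_def)
  with x obtain l' r where "l' \<in> S" "strict_mono r" "(x \<circ> r) \<longlonglongrightarrow> l'"
    using assms[of x M] by blast
  then show "l \<in> S"
    using LIMSEQ_subseq_LIMSEQ[OF x(2)] LIMSEQ_unique by blast
qed

text \<open>
  Bolzano--Weierstrass by adding one generator \<open>b\<close> at a time. The induction hypothesis makes the span
  of the earlier generators closed; so the coefficients of \<open>b\<close> stay bounded, and a subsequence of
  them converges, after which the hypothesis applies to the remainders.
\<close>

lemma bounded_seq_in_finite_span_convergent_subseq: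
  fixes B :: "'a::real_normed_vector set" and s :: "nat \<Rightarrow> 'a"
  assumes "finite B" "\<And>n. s n \<in> span B" "\<And>n. norm (s n) \<le> M"
  shows "\<exists>l\<in>span B. \<exists>r. strict_mono r \<and> (s \<circ> r) \<longlonglongrightarrow> l"
  using assms
proof (induction B arbitrary: s M rule: finite_induct)
  case empty
  then have "s \<circ> id = (\<lambda>n. 0)" by auto
  then show ?case
    by (metis span_0 strict_mono_id tendsto_const)
next
  case (insert b B)
  show ?case
  proof (cases "b \<in> span B")
    case True
    then have "span (insert b B) = span B" by (simp add: span_redundant)
    with insert show ?thesis by metis
  next
    case False
    have closed: "closed (span B)"
      using insert.IH by (rule closed_if_bounded_seqs_subconverge)
    obtain d where d: "d > 0" "\<And>c y. y \<in> span B \<Longrightarrow> \<bar>c\<bar> * d \<le> norm (c *\<^sub>R b + y)"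
      using closed_subspace_coefficient_bound[OF subspace_span closed False] by blast
    have "\<exists>c. s n - c *\<^sub>R b \<in> span B" for n
      using insert.prems(1)[of n] by (simp add: span_insert)
    then obtain c where c: "\<And>n. s n - c n *\<^sub>R b \<in> span B" by metis
    have "\<bar>c n\<bar> * d \<le> M" for n
      using d(2)[OF c[of n], of "c n"] insert.prems(2)[of n] by simp
    then have cb: "\<bar>c n\<bar> \<le> M / d" for n using d(1) by (simp add: field_simps)
    then have "bounded (range c)" by (auto simp: bounded_iff)
    then obtain c0 r where r: "strict_mono r" "(c \<circ> r) \<longlonglongrightarrow> c0"
      using bounded_imp_convergent_subsequence by blast
    define y where "y n = s (r n) - c (r n) *\<^sub>R b" for n
    have "norm (y n) \<le> M + M / d * norm b" for n
    proof -
      have "norm (y n) \<le> norm (s (r n)) + \<bar>c (r n)\<bar> * norm b"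
        unfolding y_def by (metis norm_scaleR norm_triangle_ineq4)
      also have "\<dots> \<le> M + M / d * norm b"
        by (intro add_mono mult_right_mono insert.prems cb) auto
      finally show ?thesis .
    qed
    moreover have "y n \<in> span B" for n unfolding y_def by (rule c)
    ultimately obtain y0 q where q: "y0 \<in> span B" "strict_mono q" "(y \<circ> q) \<longlonglongrightarrow> y0"
      using insert.IH by blast
    have "(\<lambda>n. (c \<circ> r \<circ> q) n *\<^sub>R b + (y \<circ> q) n) \<longlonglongrightarrow> c0 *\<^sub>R b + y0"
      by (intro tendsto_intros LIMSEQ_subseq_LIMSEQ r q)
    moreover have "(\<lambda>n. (c \<circ> r \<circ> q) n *\<^sub>R b + (y \<circ> q) n) = s \<circ> (r \<circ> q)"
      by (auto simp: y_def)
    moreover have "strict_mono (r \<circ> q)" using r q by (simp add: strict_mono_o)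
    moreover have "c0 *\<^sub>R b + y0 \<in> span (insert b B)"
      using q(1) by (simp add: span_add span_base span_mul span_clauses(1) span_insert exI[of _ c0])
    ultimately show ?thesis by metis
  qed
qed

lemma closed_span_finite:
  fixes B :: "'a::real_normed_vector set"
  assumes "finite B"
  shows "closed (span B)"
  using bounded_seq_in_finite_span_convergent_subseq[OF assms]
  by (rule closed_if_bounded_seqs_subconverge)

lemma bounded_closed_imp_compact_finite_dim:
  fixes K :: "'a::real_normed_vector set"
  assumes findim: "\<exists>B :: 'a set. finite B \<and> span B = UNIV" and K: "bounded K" "closed K"
  shows "compact K"
  unfolding compact_eq_seq_compact_metric seq_compact_def
proof (intro allI impI)
  fix s :: "nat \<Rightarrow> 'a" assume s: "\<forall>n. s n \<in> K"
  obtain B :: "'a set" where B: "finite B" "span B = UNIV" using findim by blast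
  from K(1) obtain M where "\<And>x. x \<in> K \<Longrightarrow> norm x \<le> M" by (auto simp: bounded_iff)
  with s obtain l r where lr: "strict_mono r" "(s \<circ> r) \<longlonglongrightarrow> l"
    using bounded_seq_in_finite_span_convergent_subseq[OF B(1), of s M] B(2) by auto
  moreover have "l \<in> K"
    using closed_sequentially[OF K(2), of "s \<circ> r"] s lr by auto
  ultimately show "\<exists>l\<in>K. \<exists>r. strict_mono r \<and> (s \<circ> r) \<longlonglongrightarrow> l" by blast
qed

text \<open>
  Coordinates with respect to a basis. Each is bounded because the span of the other basis vectors is
  closed.
\<close>

lemma finite_dim_bounded_coordinates:
  assumes "\<exists>B :: 'a::real_normed_vector set. finite B \<and> span B = UNIV"
  obtains B :: "'a::real_normed_vector set" and p :: "'a \<Rightarrow> ('a \<Rightarrow>\<^sub>L real)"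
  where "finite B" "\<And>x. x = (\<Sum>b\<in>B. p b x *\<^sub>R b)"
proof -
  obtain B0 :: "'a set" where B0: "finite B0" "span B0 = UNIV" using assms by blast
  obtain B where B: "B \<subseteq> B0" "independent B" "span B = UNIV"
    using maximal_independent_subset[of B0] B0(2) by (metis span_span span_mono top.extremum_uniqueI)
  have fin: "finite B" using B(1) B0(1) finite_subset by blast
  have "\<exists>q :: 'a \<Rightarrow>\<^sub>L real. \<forall>x. q x = representation B x b" if b: "b \<in> B" for b
  proof -
    have nb: "b \<notin> span (B - {b})" using B(2) b by (simp add: dependent_def)
    have cl: "closed (span (B - {b}))" by (rule closed_span_finite) (simp add: fin)
    obtain d where d: "d > 0"
        "\<And>c y. y \<in> span (B - {b}) \<Longrightarrow> \<bar>c\<bar> * d \<le> norm (c *\<^sub>R b + y)"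
      using closed_subspace_coefficient_bound[OF subspace_span cl nb] by blast
    have "bounded_linear (\<lambda>x. representation B x b)"
    proof (rule bounded_linear_intro[where K = "1 / d"])
      fix x y :: 'a and r :: real
      show "representation B (x + y) b = representation B x b + representation B y b"
        using representation_add[OF B(2)] B(3) by simp
      show "representation B (r *\<^sub>R x) b = r *\<^sub>R representation B x b"
        using representation_scale[OF B(2)] B(3) by simp
      have "x = (\<Sum>a\<in>B. representation B x a *\<^sub>R a)"
        using sum_representation_eq[OF B(2) _ fin] B(3) by auto
      also have "\<dots> = representation B x b *\<^sub>R b + (\<Sum>a\<in>B-{b}. representation B x a *\<^sub>R a)"
        using fin b by (simp add: sum.remove)
      finally have "\<bar>representation B x b\<bar> * d \<le> norm x"
        using d(2)[of "\<Sum>a\<in>B-{b}. representation B x a *\<^sub>R a" "representation B x b"]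
        by (metis (no_types, lifting) span_base span_scale span_sum)
      then show "norm (representation B x b) \<le> norm x * (1 / d)"
        using d(1) by (simp add: field_simps)
    qed
    then show ?thesis by (metis bounded_linear_Blinfun_apply)
  qed
  then obtain p :: "'a \<Rightarrow> ('a \<Rightarrow>\<^sub>L real)" where p: "\<And>b x. b \<in> B \<Longrightarrow> p b x = representation B x b"
    by metis
  have "x = (\<Sum>b\<in>B. p b x *\<^sub>R b)" for x
    using sum_representation_eq[OF B(2) _ fin, of x] B(3) p by auto
  then show thesis using that fin by blast
qed

lemma finite_dim_dual:
  assumes "\<exists>B :: 'a::real_normed_vector set. finite B \<and> span B = UNIV"
  shows "\<exists>P :: ('a::real_normed_vector \<Rightarrow>\<^sub>L real) set. finite P \<and> span P = UNIV"
proof -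
  obtain B and p :: "'a \<Rightarrow> ('a \<Rightarrow>\<^sub>L real)"
    where B: "finite B" and p: "\<And>x. x = (\<Sum>b\<in>B. p b x *\<^sub>R b)"
    using finite_dim_bounded_coordinates[OF assms] by blast
  have "v \<in> span (p ` B)" for v :: "'a \<Rightarrow>\<^sub>L real"
  proof -
    have "v = (\<Sum>b\<in>B. v b *\<^sub>R p b)"
    proof (rule blinfun_eqI)
      fix x
      have "v x = v (\<Sum>b\<in>B. p b x *\<^sub>R b)" using p[of x] by simp
      also have "\<dots> = (\<Sum>b\<in>B. v b *\<^sub>R p b) x"
        by (simp add: blinfun.sum_right blinfun.sum_left blinfun.scaleR_right blinfun.scaleR_left
            mult.commute)
      finally show "v x = (\<Sum>b\<in>B. v b *\<^sub>R p b) x" .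
    qed
    then show ?thesis by (metis (no_types, lifting) imageI span_base span_scale span_sum)
  qed
  then show ?thesis using B by (intro exI[of _ "p ` B"]) auto
qed

text \<open>
  The Euclidean norm of the coordinate vector is differentiable away from \<open>0\<close>, whereas the given norm
  need not be; a scalar factor makes it dominate the given norm. The identity \<open>D w = N w\<close> is Euler's
  for functions that are homogeneous of degree one. It shows that the gradient has norm at least \<open>1\<close>.
\<close>

lemma finite_dim_smooth_norm:
  assumes "\<exists>B :: 'a::real_normed_vector set. finite B \<and> span B = UNIV"
  obtains N :: "'a::real_normed_vector \<Rightarrow> real" and C :: real
  where "C > 0" "\<And>x. norm x \<le> N x" "\<And>x. N x \<le> C * norm x" "N 0 = 0" "continuous_on UNIV N"
    "\<And>w. w \<noteq> 0 \<Longrightarrow> \<exists>D :: 'a::real_normed_vector \<Rightarrow>\<^sub>L real. (N has_derivative D) (at w) \<and> D w = N w"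
proof -
  obtain B and p :: "'a \<Rightarrow> ('a \<Rightarrow>\<^sub>L real)"
    where B: "finite B" and p: "\<And>x. x = (\<Sum>b\<in>B. p b x *\<^sub>R b)"
    using finite_dim_bounded_coordinates[OF assms] by blast
  define m where "m = 1 + (\<Sum>b\<in>B. norm b)"
  define q where "q x = (\<Sum>b\<in>B. (p b x)\<^sup>2)" for x
  define N where "N x = m * sqrt (q x)" for x
  define C where "C = m * (1 + (\<Sum>b\<in>B. norm (p b)))"
  have m: "m \<ge> 1" unfolding m_def by (simp add: sum_nonneg)
  have q0: "q x \<ge> 0" for x unfolding q_def by (simp add: sum_nonneg)
  have lower: "norm x \<le> N x" for x
  proof -
    have le: "\<bar>p b x\<bar> \<le> sqrt (q x)" if "b \<in> B" for b
      unfolding q_def by (rule real_le_rsqrt) (use that B in \<open>auto intro: member_le_sum\<close>)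
    have "norm x \<le> (\<Sum>b\<in>B. norm (p b x *\<^sub>R b))"
      by (subst p) (rule norm_sum)
    also have "\<dots> \<le> (\<Sum>b\<in>B. sqrt (q x) * norm b)"
      by (intro sum_mono) (simp add: le mult_right_mono)
    also have "\<dots> = sqrt (q x) * (\<Sum>b\<in>B. norm b)" by (simp add: sum_distrib_left)
    also have "\<dots> \<le> N x"
      unfolding N_def m_def using q0[of x] by (simp add: algebra_simps)
    finally show ?thesis .
  qed
  have upper: "N x \<le> C * norm x" for x
  proof -
    have "sqrt (q x) \<le> (\<Sum>b\<in>B. \<bar>p b x\<bar>)"
      using L2_set_le_sum_abs[of "\<lambda>b. p b x" B] by (simp add: L2_set_def q_def)
    also have "\<dots> \<le> (\<Sum>b\<in>B. norm (p b) * norm x)"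
      by (intro sum_mono) (metis norm_blinfun real_norm_def)
    also have "\<dots> \<le> (1 + (\<Sum>b\<in>B. norm (p b))) * norm x"
      by (simp add: sum_distrib_left algebra_simps)
    finally show ?thesis unfolding N_def C_def using m by (simp add: mult.assoc mult_left_mono)
  qed
  have Cpos: "C > 0" unfolding C_def using m by (intro mult_pos_pos) (auto intro!: add_pos_nonneg sum_nonneg)
  have cont: "continuous_on UNIV N"
    unfolding N_def q_def by (intro continuous_intros)
  have deriv: "\<exists>D :: 'a \<Rightarrow>\<^sub>L real. (N has_derivative D) (at w) \<and> D w = N w" if w: "w \<noteq> 0" for w
  proof -
    have "q w \<noteq> 0" using lower[of w] w by (auto simp: N_def)
    then have qw: "q w > 0" using q0[of w] by simp
    have "((\<lambda>x. \<Sum>b\<in>B. (p b x)\<^sup>2) has_derivative (\<lambda>h. \<Sum>b\<in>B. 2 * p b w * p b h)) (at w)"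
      by (auto intro!: derivative_eq_intros simp: mult_ac)
    then have "(q has_derivative (\<lambda>h. \<Sum>b\<in>B. 2 * p b w * p b h)) (at w)"
      by (simp add: q_def[abs_def])
    then have N': "(N has_derivative (\<lambda>h. m * ((\<Sum>b\<in>B. 2 * p b w * p b h) * (inverse (sqrt (q w)) / 2)))) (at w)"
      unfolding N_def[abs_def] using qw by (auto intro!: derivative_eq_intros simp: field_simps)
    then have bl: "bounded_linear (\<lambda>h. m * ((\<Sum>b\<in>B. 2 * p b w * p b h) * (inverse (sqrt (q w)) / 2)))"
      by (rule has_derivative_bounded_linear)
    have "(\<Sum>b\<in>B. 2 * p b w * p b w) = 2 * (sqrt (q w))\<^sup>2"
      using q0[of w] by (simp add: q_def power2_eq_square sum_distrib_left mult.assoc)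
    then have "m * ((\<Sum>b\<in>B. 2 * p b w * p b w) * (inverse (sqrt (q w)) / 2)) = N w"
      using qw by (simp add: N_def power2_eq_square field_simps)
    with N' bl show ?thesis
      by (intro exI[of _ "Blinfun (\<lambda>h. m * ((\<Sum>b\<in>B. 2 * p b w * p b h) * (inverse (sqrt (q w)) / 2)))"])
        (simp add: bounded_linear_Blinfun_apply)
  qed
  have "N 0 = 0" by (simp add: N_def q_def blinfun.zero_right)
  then show thesis using that Cpos lower upper cont deriv by blast
qed

section \<open>Strict derivatives and subgradients of real-valued functions\<close>

definition strict_derivative_at ::
    "('a::real_normed_vector \<Rightarrow> real) \<Rightarrow> ('a \<Rightarrow>\<^sub>L real) \<Rightarrow> 'a \<Rightarrow> bool" where
  "strict_derivative_at F v xbar \<longleftrightarrow>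
     (\<forall>e>0. \<exists>\<delta>>0. \<forall>x\<in>ball xbar \<delta>. \<forall>y\<in>ball xbar \<delta>. \<bar>F x - F y - v (x - y)\<bar> \<le> e * norm (x - y))"

text \<open>
  The \<^const>\<open>Liminf\<close> condition of \<^const>\<open>eps_subdifferential\<close>, with the quotient cleared, for a
  real-valued function.
\<close>

definition eps_subgradient ::
    "real \<Rightarrow> ('a::real_normed_vector \<Rightarrow> real) \<Rightarrow> 'a \<Rightarrow> ('a \<Rightarrow>\<^sub>L real) \<Rightarrow> bool" where
  "eps_subgradient \<epsilon> F x w \<longleftrightarrow>
     (\<forall>\<eta>>0. \<forall>\<^sub>F u in at x. - (\<epsilon> + \<eta>) * norm (u - x) \<le> F u - F x - w (u - x))"

text \<open>
  By homogeneity a bound near one point holds in every direction \<open>d\<close>, and with \<open>- d\<close> in place of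
  \<open>d\<close> it becomes two-sided.
\<close>

lemma norm_blinfun_le_if_locally_bounded_below:
  fixes A :: "'a::real_normed_vector \<Rightarrow>\<^sub>L real"
  assumes "a \<ge> 0" and ev: "\<forall>\<^sub>F u in at x. - a * norm (u - x) \<le> A (u - x)"
  shows "norm A \<le> a"
proof (rule norm_blinfun_bound[OF assms(1)])
  obtain \<delta> where \<delta>: "\<delta> > 0" "\<And>u. u \<noteq> x \<Longrightarrow> dist u x < \<delta> \<Longrightarrow> - a * norm (u - x) \<le> A (u - x)"
    using ev by (auto simp: eventually_at)
  have below: "- (a * norm d) \<le> A d" for d
  proof (cases "d = 0")
    case False
    define t where "t = \<delta> / (2 * norm d)"
    have t: "t > 0" using False \<delta>(1) by (simp add: t_def)
    have "dist (x + t *\<^sub>R d) x < \<delta>"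
      using False \<delta>(1) by (simp add: t_def dist_norm)
    with \<delta>(2)[of "x + t *\<^sub>R d"] False t
    have "- a * (t * norm d) \<le> t * A d" by (simp add: blinfun.scaleR_right)
    then have "t * (- (a * norm d)) \<le> t * A d" by (simp add: algebra_simps)
    with t show ?thesis using mult_le_cancel_left_pos by blast
  qed (simp add: blinfun.zero_right)
  show "norm (A d) \<le> a * norm d" for d
    using below[of d] below[of "- d"] by (simp add: blinfun.minus_right)
qed

lemma eps_subgradient_of_strict_derivative:
  assumes "strict_derivative_at F v x"
  shows "eps_subgradient 0 F x v"
  unfolding eps_subgradient_def
proof (intro allI impI)
  fix \<eta> :: real assume "\<eta> > 0"
  with assms obtain \<delta> where \<delta>: "\<delta> > 0"
      "\<And>u y. u \<in> ball x \<delta> \<Longrightarrow> y \<in> ball x \<delta> \<Longrightarrow> \<bar>F u - F y - v (u - y)\<bar> \<le> \<eta> * norm (u - y)"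
    unfolding strict_derivative_at_def by blast
  have "- (0 + \<eta>) * norm (u - x) \<le> F u - F x - v (u - x)" if "dist u x < \<delta>" for u
    using \<delta>(2)[of u x] \<delta>(1) that by (simp add: dist_commute abs_le_iff)
  then show "\<forall>\<^sub>F u in at x. - (0 + \<eta>) * norm (u - x) \<le> F u - F x - v (u - x)"
    using \<delta>(1) by (auto simp: eventually_at)
qed

text \<open>
  The increments of \<open>F\<close> are at most those of \<open>v\<close>, and at least those of \<open>w\<close>, up to small errors; so the
  linear functional \<open>v - w\<close> is nearly nonnegative, which for a linear functional means nearly zero. The
  radius does not depend on \<open>\<epsilon>\<close>, so that the bound can be used along a sequence of them.
\<close>

lemma subgradients_near_strict_derivative:
  assumes sd: "strict_derivative_at F v xbar" and "e > 0"
  obtains \<delta> where "\<delta> > 0"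
    "\<And>x w \<epsilon>. x \<in> ball xbar \<delta> \<Longrightarrow> \<epsilon> \<ge> 0 \<Longrightarrow> eps_subgradient \<epsilon> F x w \<Longrightarrow> norm (w - v) \<le> \<epsilon> + e"
proof -
  have e2: "e / 2 > 0" using \<open>e > 0\<close> by simp
  with sd obtain \<delta> where \<delta>: "\<delta> > 0"
      "\<And>x y. x \<in> ball xbar \<delta> \<Longrightarrow> y \<in> ball xbar \<delta> \<Longrightarrow>
        \<bar>F x - F y - v (x - y)\<bar> \<le> e / 2 * norm (x - y)"
    unfolding strict_derivative_at_def by blast
  have "norm (w - v) \<le> \<epsilon> + e" if x: "x \<in> ball xbar \<delta>" and "\<epsilon> \<ge> 0" and w: "eps_subgradient \<epsilon> F x w" for x w \<epsilon>
  proof -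
    have "\<forall>\<^sub>F u in at x. - (\<epsilon> + e / 2) * norm (u - x) \<le> F u - F x - w (u - x)"
      using w e2 unfolding eps_subgradient_def by blast
    moreover have "\<forall>\<^sub>F u in at x. u \<in> ball xbar \<delta>"
      using x by (intro eventually_at_in_open') auto
    ultimately have "\<forall>\<^sub>F u in at x. - (\<epsilon> + e) * norm (u - x) \<le> (v - w) (u - x)"
    proof eventually_elim
      case (elim u)
      then have "F u - F x - v (u - x) \<le> e / 2 * norm (u - x)"
        using order_trans[OF abs_ge_self \<delta>(2)[OF _ x]] by blast
      moreover have "- (\<epsilon> + e) * norm (u - x)
          = - (\<epsilon> + e / 2) * norm (u - x) - e / 2 * norm (u - x)"
        by (simp add: algebra_simps)
      ultimately show ?case using elim(1) unfolding blinfun.diff_left by linarith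
    qed
    then have "norm (v - w) \<le> \<epsilon> + e"
      using \<open>\<epsilon> \<ge> 0\<close> \<open>e > 0\<close> by (intro norm_blinfun_le_if_locally_bounded_below) auto
    then show ?thesis by (simp add: norm_minus_commute)
  qed
  then show thesis using that \<delta>(1) by blast
qed

lemma strict_derivative_imp_has_derivative:
  assumes "strict_derivative_at F v x"
  shows "(F has_derivative v) (at x)"
  unfolding has_derivative_at_alt
proof (intro conjI allI impI)
  fix e :: real assume "e > 0"
  with assms obtain \<delta> where \<delta>: "\<delta> > 0"
      "\<And>u y. u \<in> ball x \<delta> \<Longrightarrow> y \<in> ball x \<delta> \<Longrightarrow> \<bar>F u - F y - v (u - y)\<bar> \<le> e * norm (u - y)"
    unfolding strict_derivative_at_def by blast
  then show "\<exists>d>0. \<forall>y. norm (y - x) < d \<longrightarrow> norm (F y - F x - v (y - x)) \<le> e * norm (y - x)"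
    by (intro exI[of _ \<delta>]) (auto simp: dist_norm norm_minus_commute)
qed (rule blinfun.bounded_linear_right)

lemma strict_derivative_imp_lipschitz:
  assumes "strict_derivative_at F v xbar"
  obtains l \<delta> where "l \<ge> 0" "\<delta> > 0"
    "\<And>x w. x \<in> ball xbar \<delta> \<Longrightarrow> w \<in> ball xbar \<delta> \<Longrightarrow> \<bar>F x - F w\<bar> \<le> l * norm (x - w)"
proof -
  obtain \<delta> where \<delta>: "\<delta> > 0"
      "\<And>x w. x \<in> ball xbar \<delta> \<Longrightarrow> w \<in> ball xbar \<delta> \<Longrightarrow> \<bar>F x - F w - v (x - w)\<bar> \<le> 1 * norm (x - w)"
    using assms zero_less_one unfolding strict_derivative_at_def by blast
  have "\<bar>F x - F w\<bar> \<le> (1 + norm v) * norm (x - w)" if "x \<in> ball xbar \<delta>" "w \<in> ball xbar \<delta>" for x w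
    using \<delta>(2)[OF that] norm_blinfun[of v "x - w"] by (simp add: algebra_simps)
  then show thesis using that[of "1 + norm v" \<delta>] \<delta>(1) by simp
qed

text \<open>
  This bound gives the compactness needed to extract limiting subgradients.
\<close>

lemma norm_subgradient_le_lipschitz:
  assumes "l \<ge> 0" "r > 0" and lip: "\<And>u. u \<in> ball x r \<Longrightarrow> \<bar>F u - F x\<bar> \<le> l * norm (u - x)"
    and w: "eps_subgradient 0 F x w"
  shows "norm w \<le> l"
proof (rule field_le_epsilon)
  fix e :: real assume e: "e > 0"
  have "\<forall>\<^sub>F u in at x. - (0 + e) * norm (u - x) \<le> F u - F x - w (u - x)"
    using w e unfolding eps_subgradient_def by blast
  moreover have "\<forall>\<^sub>F u in at x. u \<in> ball x r"
    using assms(2) by (intro eventually_at_in_open') auto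
  ultimately have "\<forall>\<^sub>F u in at x. - (l + e) * norm (u - x) \<le> (- w) (u - x)"
  proof eventually_elim
    case (elim u)
    then show ?case using lip[of u] by (simp add: blinfun.minus_left algebra_simps)
  qed
  then have "norm (- w) \<le> l + e"
    using assms(1) e by (intro norm_blinfun_le_if_locally_bounded_below) auto
  then show "norm w \<le> l + e" by simp
qed

text \<open>
  Fermat's rule. It turns the gradient of a penalty at a minimiser into a subgradient.
\<close>

lemma eps_subgradient_at_local_min:
  fixes D :: "'a::real_normed_vector \<Rightarrow>\<^sub>L real"
  assumes D: "(\<phi> has_derivative D) (at z)"
    and min: "\<forall>\<^sub>F u in at z. G z + \<phi> z \<le> G u + \<phi> u"
  shows "eps_subgradient 0 G z (- D)"
  unfolding eps_subgradient_def
proof (intro allI impI)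
  fix \<eta> :: real assume "\<eta> > 0"
  with D obtain d where "d > 0"
      "\<And>y. norm (y - z) < d \<Longrightarrow> norm (\<phi> y - \<phi> z - D (y - z)) \<le> \<eta> * norm (y - z)"
    unfolding has_derivative_at_alt by blast
  then have "\<forall>\<^sub>F u in at z. \<bar>\<phi> u - \<phi> z - D (u - z)\<bar> \<le> \<eta> * norm (u - z)"
    by (auto simp: eventually_at dist_norm)
  with min show "\<forall>\<^sub>F u in at z. - (0 + \<eta>) * norm (u - z) \<le> G u - G z - (- D) (u - z)"
    by eventually_elim (auto simp: blinfun.minus_left abs_le_iff algebra_simps)
qed

text \<open>
  A substitute for the mean value theorem. The right-hand side is \<open>G a\<close> plus a penalty at \<open>a\<close>, and the
  claim says that \<open>b\<close> minimises the penalised function. The linear part of the penalty has gradient of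
  norm at least \<open>\<eta>\<close> away from \<open>b\<close>, too steep for a minimum there. The coefficient \<open>L / \<rho>\<close> of
  the quadratic part makes the penalty exceed \<open>L * \<rho>\<close>, the largest possible descent of \<open>G\<close>, on the
  boundary of the ball.
\<close>

lemma increment_bound_from_subgradient_bound:
  fixes G :: "'a::real_normed_vector \<Rightarrow> real"
  assumes findim: "\<exists>B :: 'a set. finite B \<and> span B = UNIV"
    and N: "\<And>x. norm x \<le> N x" "N 0 = 0" "continuous_on UNIV N"
      "\<And>w. w \<noteq> 0 \<Longrightarrow> \<exists>D :: 'a \<Rightarrow>\<^sub>L real. (N has_derivative D) (at w) \<and> D w = N w"
    and "\<rho> > 0" "L \<ge> 0" "\<eta> > 0"
    and cont: "continuous_on (cball b \<rho>) G"
    and lip: "\<And>z. z \<in> cball b \<rho> \<Longrightarrow> \<bar>G z - G b\<bar> \<le> L * norm (z - b)"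
    and sub: "\<And>z w. z \<in> ball b \<rho> \<Longrightarrow> eps_subgradient 0 G z w \<Longrightarrow> norm w < \<eta>"
    and a: "a \<in> cball b \<rho>"
  shows "G b \<le> G a + \<eta> * N (a - b) + L / \<rho> * (N (a - b))\<^sup>2"
proof -
  define \<phi> where "\<phi> u = \<eta> * N (u - b) + L / \<rho> * (N (u - b))\<^sup>2" for u
  have Npos: "N x \<ge> 0" for x using N(1)[of x] norm_ge_zero[of x] by linarith
  have compact: "compact (cball b \<rho>)"
    by (intro bounded_closed_imp_compact_finite_dim findim bounded_cball closed_cball)
  have "continuous_on (cball b \<rho>) (\<lambda>u. N (u - b))"
    by (rule continuous_on_compose2[OF N(3)]) (auto intro!: continuous_intros)
  then have "continuous_on (cball b \<rho>) (\<lambda>u. G u + \<phi> u)"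
    unfolding \<phi>_def by (intro continuous_intros cont)
  moreover have "cball b \<rho> \<noteq> {}" using \<open>\<rho> > 0\<close> by simp
  ultimately obtain z where z: "z \<in> cball b \<rho>"
    and zmin: "\<And>u. u \<in> cball b \<rho> \<Longrightarrow> G z + \<phi> z \<le> G u + \<phi> u"
    using continuous_attains_inf[OF compact] by blast
  have \<phi>b: "\<phi> b = 0" by (simp add: \<phi>_def N(2))
  have zb: "G z + \<phi> z \<le> G b" using zmin[of b] \<open>\<rho> > 0\<close> \<phi>b by simp
  have "z = b"
  proof (rule ccontr)
    assume "z \<noteq> b"
    \<comment> \<open>A minimiser on the boundary would have a value above that at \<open>b\<close>.\<close>
    have "norm (z - b) \<noteq> \<rho>"
    proof
      assume eq: "norm (z - b) = \<rho>"
      have "\<rho> \<le> N (z - b)" using N(1)[of "z - b"] eq by simp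
      then have "\<eta> * \<rho> + L / \<rho> * \<rho>\<^sup>2 \<le> \<phi> z"
        unfolding \<phi>_def using \<open>\<rho> > 0\<close> \<open>L \<ge> 0\<close> \<open>\<eta> > 0\<close>
        by (intro add_mono mult_left_mono power_mono) auto
      then have "\<eta> * \<rho> + L * \<rho> \<le> \<phi> z" using \<open>\<rho> > 0\<close> by (simp add: power2_eq_square)
      moreover have "0 < \<eta> * \<rho>" using \<open>\<rho> > 0\<close> \<open>\<eta> > 0\<close> by simp
      ultimately show False using zb lip[OF z] eq by (simp add: abs_le_iff)
    qed
    then have zball: "z \<in> ball b \<rho>" using z by (simp add: dist_norm norm_minus_commute)
    obtain D :: "'a \<Rightarrow>\<^sub>L real" where D: "(N has_derivative D) (at (z - b))" "D (z - b) = N (z - b)"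
      using N(4)[of "z - b"] \<open>z \<noteq> b\<close> by auto
    define c where "c = \<eta> + 2 * (L / \<rho>) * N (z - b)"
    have "((\<lambda>u. u - b) has_derivative (\<lambda>h. h)) (at z)" by (auto intro!: derivative_eq_intros)
    then have "((\<lambda>u. N (u - b)) has_derivative D) (at z)"
      using has_derivative_compose[of "\<lambda>u. u - b" "\<lambda>h. h" z UNIV N D] D(1) by simp
    then have "((\<lambda>u. \<eta> * N (u - b) + K * (N (u - b))\<^sup>2) has_derivative
        (\<lambda>h. (\<eta> + 2 * K * N (z - b)) * D h)) (at z)" for K
      by (auto intro!: derivative_eq_intros simp: fun_eq_iff algebra_simps)
    from this[of "L / \<rho>"] have "(\<phi> has_derivative (\<lambda>h. c * D h)) (at z)"
      unfolding \<phi>_def[abs_def] c_def .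
    moreover have "blinfun_apply (c *\<^sub>R D) = (\<lambda>h. c * D h)"
      by (simp add: fun_eq_iff blinfun.scaleR_left)
    ultimately have "(\<phi> has_derivative (c *\<^sub>R D)) (at z)" by simp
    moreover have "\<forall>\<^sub>F u in at z. u \<in> ball b \<rho>"
      using zball by (intro eventually_at_in_open') auto
    then have "\<forall>\<^sub>F u in at z. G z + \<phi> z \<le> G u + \<phi> u"
      by eventually_elim (auto intro: zmin)
    ultimately have "eps_subgradient 0 G z (- (c *\<^sub>R D))"
      by (rule eps_subgradient_at_local_min)
    then have small: "norm (c *\<^sub>R D) < \<eta>" using sub[OF zball] by force
    \<comment> \<open>Evaluating the gradient of the penalty at \<open>z - b\<close> shows that its norm is at least \<open>\<eta>\<close>.\<close>
    have "\<eta> * norm (z - b) \<le> c * N (z - b)"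
      unfolding c_def using N(1) Npos \<open>\<rho> > 0\<close> \<open>L \<ge> 0\<close> \<open>\<eta> > 0\<close> by (intro mult_mono) auto
    also have "\<dots> = (c *\<^sub>R D) (z - b)" by (simp add: blinfun.scaleR_left D(2))
    also have "\<dots> \<le> norm (c *\<^sub>R D) * norm (z - b)"
      using norm_blinfun[of "c *\<^sub>R D" "z - b"] by simp
    also have "\<dots> < \<eta> * norm (z - b)" using small \<open>z \<noteq> b\<close> by simp
    finally show False by simp
  qed
  then show ?thesis using zmin[OF a] \<phi>b by (simp add: \<phi>_def)
qed

lemma eps_subgradient_diff_linear:
  fixes v w :: "'a::real_normed_vector \<Rightarrow>\<^sub>L real"
  shows "eps_subgradient \<epsilon> (\<lambda>x. F x - v x) z w \<longleftrightarrow> eps_subgradient \<epsilon> F z (w + v)"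
  unfolding eps_subgradient_def
  by (simp add: blinfun.add_left blinfun.diff_right algebra_simps)

text \<open>
  The increment bound is applied to \<open>F - v\<close>, whose subgradients near \<open>xbar\<close> are small.
\<close>

lemma strict_derivative_if_subgradients_converge:
  fixes F :: "'a::real_normed_vector \<Rightarrow> real" and v :: "'a \<Rightarrow>\<^sub>L real"
  assumes findim: "\<exists>B :: 'a set. finite B \<and> span B = UNIV"
    and "l \<ge> 0" "\<delta> > 0"
    and lip: "\<And>x w. x \<in> ball xbar \<delta> \<Longrightarrow> w \<in> ball xbar \<delta> \<Longrightarrow> \<bar>F x - F w\<bar> \<le> l * norm (x - w)"
    and sub: "\<And>\<eta>. \<eta> > 0 \<Longrightarrow>
      \<exists>\<sigma>>0. \<forall>x\<in>ball xbar \<sigma>. \<forall>w. eps_subgradient 0 F x w \<longrightarrow> norm (w - v) < \<eta>"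
  shows "strict_derivative_at F v xbar"
  unfolding strict_derivative_at_def
proof (intro allI impI)
  fix e :: real assume "e > 0"
  obtain N :: "'a \<Rightarrow> real" and C where "C > 0"
    and N: "\<And>x. norm x \<le> N x" "N 0 = 0" "continuous_on UNIV N"
      "\<And>w. w \<noteq> 0 \<Longrightarrow> \<exists>D :: 'a \<Rightarrow>\<^sub>L real. (N has_derivative D) (at w) \<and> D w = N w"
    and N_le: "\<And>x. N x \<le> C * norm x"
    using finite_dim_smooth_norm[OF findim] by metis
  \<comment> \<open>With this \<open>\<eta>\<close> the linear part of the penalty is at most \<open>e / 2\<close> times the distance.\<close>
  define \<eta> where "\<eta> = e / (2 * C)"
  have \<eta>: "\<eta> > 0" using \<open>e > 0\<close> \<open>C > 0\<close> by (simp add: \<eta>_def)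
  obtain \<sigma> where \<sigma>: "\<sigma> > 0"
      "\<And>x w. x \<in> ball xbar \<sigma> \<Longrightarrow> eps_subgradient 0 F x w \<Longrightarrow> norm (w - v) < \<eta>"
    using sub[OF \<eta>] by blast
  define G where "G x = F x - v x" for x
  define L where "L = l + norm v"
  \<comment> \<open>Balls of radius \<open>\<rho>\<close> about points of \<open>ball xbar \<rho>\<close> must stay where both hypotheses apply.\<close>
  define \<rho> where "\<rho> = min \<delta> \<sigma> / 3"
  have L: "L \<ge> 0" using \<open>l \<ge> 0\<close> by (simp add: L_def)
  have \<rho>: "\<rho> > 0" "2 * \<rho> < \<delta>" "2 * \<rho> < \<sigma>" using \<open>\<delta> > 0\<close> \<sigma>(1) by (auto simp: \<rho>_def min_def)
  have G_lip: "\<bar>G x - G w\<bar> \<le> L * norm (x - w)" if "x \<in> ball xbar \<delta>" "w \<in> ball xbar \<delta>" for x w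
  proof -
    have "G x - G w = (F x - F w) - v (x - w)" by (simp add: G_def blinfun.diff_right)
    then show ?thesis
      using lip[OF that] norm_blinfun[of v "x - w"] by (simp add: L_def algebra_simps abs_le_iff)
  qed
  have one_sided: "G b \<le> G a + \<eta> * N (a - b) + L / \<rho> * (N (a - b))\<^sup>2"
    if b: "b \<in> ball xbar \<rho>" and a: "a \<in> cball b \<rho>" for a b
  proof (rule increment_bound_from_subgradient_bound[OF findim N \<rho>(1) L \<eta> _ _ _ a])
    have near: "dist xbar z < 2 * \<rho>" if "z \<in> cball b \<rho>" for z
      using that b dist_triangle[of xbar z b] by simp
    then have in_\<delta>: "cball b \<rho> \<subseteq> ball xbar \<delta>" and in_\<sigma>: "cball b \<rho> \<subseteq> ball xbar \<sigma>"
      using \<rho>(2,3) by fastforce+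
    have "L-lipschitz_on (cball b \<rho>) G"
      using G_lip in_\<delta> L by (auto intro!: lipschitz_onI simp: dist_norm subset_iff)
    then show "continuous_on (cball b \<rho>) G" by (rule lipschitz_on_continuous_on)
    show "\<bar>G z - G b\<bar> \<le> L * norm (z - b)" if "z \<in> cball b \<rho>" for z
      using that in_\<delta> \<rho>(1) by (intro G_lip) (auto simp del: mem_ball)
    show "norm w < \<eta>" if "z \<in> ball b \<rho>" "eps_subgradient 0 G z w" for z w
      using that \<sigma>(2)[of z "w + v"] subsetD[OF in_\<sigma>, of z] eps_subgradient_diff_linear[of 0 F v z w]
      by (simp add: G_def[abs_def])
  qed
  define K where "K = L / \<rho> * C\<^sup>2"
  have K: "K \<ge> 0" using L \<rho>(1) by (simp add: K_def)
  \<comment> \<open>Points of \<open>ball xbar \<tau>\<close> are so close that the quadratic part is also at most \<open>e / 2\<close> times their distance.\<close>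
  define \<tau> where "\<tau> = min (\<rho> / 2) (e / (4 * (K + 1)))"
  have \<tau>: "\<tau> > 0" using \<rho>(1) \<open>e > 0\<close> K by (simp add: \<tau>_def)
  have diff: "G b - G a \<le> e * norm (a - b)" if "a \<in> ball xbar \<tau>" "b \<in> ball xbar \<tau>" for a b
  proof -
    have ab: "norm (a - b) < 2 * \<tau>"
      using that dist_triangle3[of a b xbar] by (simp add: dist_norm)
    have t1: "2 * \<tau> \<le> \<rho>" by (simp add: \<tau>_def)
    have t2: "\<tau> \<le> e / (4 * (K + 1))" by (simp add: \<tau>_def)
    have "G b - G a \<le> \<eta> * N (a - b) + L / \<rho> * (N (a - b))\<^sup>2"
      using one_sided[of b a] that ab t1 \<tau> by (simp add: dist_norm norm_minus_commute)
    also have "\<dots> \<le> \<eta> * (C * norm (a - b)) + L / \<rho> * (C * norm (a - b))\<^sup>2"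
      using \<eta> L \<rho>(1) N_le N(1) by (intro add_mono mult_left_mono power_mono order_trans[OF norm_ge_zero N(1)]) auto
    also have "\<dots> = e / 2 * norm (a - b) + (K * norm (a - b)) * norm (a - b)"
      using \<open>C > 0\<close> by (simp add: \<eta>_def K_def power2_eq_square field_simps)
    also have "\<dots> \<le> e / 2 * norm (a - b) + e / 2 * norm (a - b)"
    proof (intro add_left_mono mult_right_mono)
      have "norm (a - b) \<le> 2 * (e / (4 * (K + 1)))" using ab t2 by linarith
      then have "K * norm (a - b) \<le> (K + 1) * (2 * (e / (4 * (K + 1))))"
        using K by (intro mult_mono) auto
      also have "\<dots> = e / 2" using K by (simp add: field_simps)
      finally show "K * norm (a - b) \<le> e / 2" .
    qed simp
    finally show ?thesis by simp
  qed
  have "\<bar>F x - F y - v (x - y)\<bar> \<le> e * norm (x - y)" if "x \<in> ball xbar \<tau>" "y \<in> ball xbar \<tau>" for x y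
  proof -
    have "F x - F y - v (x - y) = G x - G y" by (simp add: G_def blinfun.diff_right)
    then show ?thesis
      using diff[OF that] diff[OF that(2,1)] norm_minus_commute[of x y] by (simp add: abs_le_iff)
  qed
  with \<tau> show "\<exists>\<delta>>0. \<forall>x\<in>ball xbar \<delta>. \<forall>y\<in>ball xbar \<delta>. \<bar>F x - F y - v (x - y)\<bar> \<le> e * norm (x - y)"
    by (intro exI[of _ \<tau>] conjI ballI) auto
qed

section \<open>Passing from extended-real to real-valued functions\<close>

lemma interior_domain_real_near:
  assumes proper: "\<And>x. f x \<noteq> -\<infinity>" and "x \<in> interior (effective_domain f)"
  obtains r where "r > 0" "\<And>u. u \<in> ball x r \<Longrightarrow> f u = ereal (real_of_ereal (f u))"
proof -
  obtain r where r: "r > 0" "ball x r \<subseteq> effective_domain f"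
    using assms(2) by (auto simp: mem_interior)
  have "f u = ereal (real_of_ereal (f u))" if "u \<in> ball x r" for u
    using that r(2) proper[of u] by (cases "f u") (auto simp: effective_domain_def subset_iff)
  then show thesis using that r(1) by blast
qed

lemma interior_domain_if_real_near:
  assumes "r > 0" "\<And>u. u \<in> ball x r \<Longrightarrow> f u = ereal (F u)"
  shows "x \<in> interior (effective_domain f)"
  using assms by (auto simp: mem_interior effective_domain_def intro!: exI[of _ r])

lemma eventually_at_off_diagonal:
  fixes a :: "'a::real_normed_vector"
  shows "(\<forall>\<^sub>F p in at (a, a) within {(x, y). x \<noteq> y}. P p) \<longleftrightarrow>
    (\<exists>\<delta>>0. \<forall>x\<in>ball a \<delta>. \<forall>y\<in>ball a \<delta>. x \<noteq> y \<longrightarrow> P (x, y))"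
proof
  assume "\<forall>\<^sub>F p in at (a, a) within {(x, y). x \<noteq> y}. P p"
  then obtain d where d: "d > 0"
      "\<And>x y. x \<noteq> y \<Longrightarrow> dist (x, y) (a, a) < d \<Longrightarrow> P (x, y)"
    by (auto simp: eventually_at)
  have "P (x, y)" if "x \<in> ball a (d / 2)" "y \<in> ball a (d / 2)" "x \<noteq> y" for x y
  proof (rule d(2)[OF that(3)])
    have "dist (x, y) (a, a) \<le> dist x a + dist y a"
      by (simp add: dist_Pair_Pair sqrt_sum_squares_le_sum)
    also have "\<dots> < d" using that by (simp add: dist_commute)
    finally show "dist (x, y) (a, a) < d" .
  qed
  then show "\<exists>\<delta>>0. \<forall>x\<in>ball a \<delta>. \<forall>y\<in>ball a \<delta>. x \<noteq> y \<longrightarrow> P (x, y)"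
    using d(1) by (intro exI[of _ "d / 2"]) auto
next
  assume "\<exists>\<delta>>0. \<forall>x\<in>ball a \<delta>. \<forall>y\<in>ball a \<delta>. x \<noteq> y \<longrightarrow> P (x, y)"
  then obtain \<delta> where \<delta>: "\<delta> > 0" "\<And>x y. x \<in> ball a \<delta> \<Longrightarrow> y \<in> ball a \<delta> \<Longrightarrow> x \<noteq> y \<Longrightarrow> P (x, y)"
    by blast
  have "P (x, y)" if "x \<noteq> y" "dist (x, y) (a, a) < \<delta>" for x y
    using that dist_fst_le[of "(x, y)" "(a, a)"] dist_snd_le[of "(x, y)" "(a, a)"]
    by (intro \<delta>(2)) (auto simp: dist_commute)
  then show "\<forall>\<^sub>F p in at (a, a) within {(x, y). x \<noteq> y}. P p"
    using \<delta>(1) by (auto simp: eventually_at intro!: exI[of _ \<delta>])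
qed

lemma eventually_nhds_at_right_0:
  fixes a :: "'a::real_normed_vector"
  shows "(\<forall>\<^sub>F (x, t) in nhds a \<times>\<^sub>F at_right (0::real). P x t) \<longleftrightarrow>
    (\<exists>\<delta>>0. \<forall>x\<in>ball a \<delta>. \<forall>t. 0 < t \<and> t < \<delta> \<longrightarrow> P x t)"
proof
  assume "\<forall>\<^sub>F (x, t) in nhds a \<times>\<^sub>F at_right (0::real). P x t"
  then obtain Q R where Q: "eventually Q (nhds a)" and R: "eventually R (at_right (0::real))"
    and P: "\<And>x t. Q x \<Longrightarrow> R t \<Longrightarrow> P x t"
    by (auto simp: eventually_prod_filter)
  obtain d where d: "d > 0" "\<And>x. dist x a < d \<Longrightarrow> Q x"
    using Q by (auto simp: eventually_nhds_metric)
  obtain d' where d': "d' > 0" "\<And>t. 0 < t \<Longrightarrow> t < d' \<Longrightarrow> R t"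
    using R by (auto simp: eventually_at_right_field)
  show "\<exists>\<delta>>0. \<forall>x\<in>ball a \<delta>. \<forall>t. 0 < t \<and> t < \<delta> \<longrightarrow> P x t"
    using d d' P by (intro exI[of _ "min d d'"]) (auto simp: dist_commute)
next
  assume "\<exists>\<delta>>0. \<forall>x\<in>ball a \<delta>. \<forall>t. 0 < t \<and> t < \<delta> \<longrightarrow> P x t"
  then obtain \<delta> where \<delta>: "\<delta> > 0" "\<And>x t. x \<in> ball a \<delta> \<Longrightarrow> 0 < t \<Longrightarrow> t < \<delta> \<Longrightarrow> P x t" by blast
  have "eventually (\<lambda>x. x \<in> ball a \<delta>) (nhds a)"
    using \<delta>(1) by (intro eventually_nhds_in_open) auto
  moreover have "eventually (\<lambda>t. 0 < t \<and> t < \<delta>) (at_right 0)"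
    using \<delta>(1) by (auto simp: eventually_at_right_field)
  ultimately show "\<forall>\<^sub>F (x, t) in nhds a \<times>\<^sub>F at_right (0::real). P x t"
    unfolding eventually_prod_filter using \<delta>(2) by fastforce
qed

lemma frechet_strictly_differentiable_iff_strict_derivative:
  fixes f :: "'a::real_normed_vector \<Rightarrow> ereal"
  assumes r: "r > 0" and F: "\<And>u. u \<in> ball xbar r \<Longrightarrow> f u = ereal (F u)"
  shows "frechet_strictly_differentiable_at f xbar \<longleftrightarrow> (\<exists>v. strict_derivative_at F v xbar)"
proof -
  have "((\<lambda>(x, y). (f x - f y - ereal (v (x - y))) / ereal (norm (x - y))) \<longlongrightarrow> 0)
          (at (xbar, xbar) within {(x, y). x \<noteq> y}) \<longleftrightarrow> strict_derivative_at F v xbar"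
    (is "?lim \<longleftrightarrow> _") for v :: "'a \<Rightarrow>\<^sub>L real"
  proof -
    define q where "q p = (F (fst p) - F (snd p) - v (fst p - snd p)) / norm (fst p - snd p)" for p
    have "\<forall>\<^sub>F p in at (xbar, xbar) within {(x, y). x \<noteq> y}.
        (case p of (x, y) \<Rightarrow> (f x - f y - ereal (v (x - y))) / ereal (norm (x - y))) = ereal (q p)"
      unfolding eventually_at_off_diagonal
      using r by (intro exI[of _ r]) (auto simp: F q_def)
    then have "?lim \<longleftrightarrow> ((\<lambda>p. ereal (q p)) \<longlongrightarrow> ereal 0) (at (xbar, xbar) within {(x, y). x \<noteq> y})"
      by (simp add: zero_ereal_def tendsto_cong)
    also have "\<dots> \<longleftrightarrow> (\<forall>e>0. \<exists>\<delta>>0. \<forall>x\<in>ball xbar \<delta>. \<forall>y\<in>ball xbar \<delta>. x \<noteq> y \<longrightarrow> \<bar>q (x, y)\<bar> < e)"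
      unfolding lim_ereal tendsto_iff eventually_at_off_diagonal dist_real_def diff_0_right ..
    also have "\<dots> \<longleftrightarrow> strict_derivative_at F v xbar"
    proof
      assume *: "\<forall>e>0. \<exists>\<delta>>0. \<forall>x\<in>ball xbar \<delta>. \<forall>y\<in>ball xbar \<delta>. x \<noteq> y \<longrightarrow> \<bar>q (x, y)\<bar> < e"
      show "strict_derivative_at F v xbar"
        unfolding strict_derivative_at_def
      proof (intro allI impI)
        fix e :: real assume "e > 0"
        then obtain \<delta> where \<delta>: "\<delta> > 0"
            "\<And>x y. x \<in> ball xbar \<delta> \<Longrightarrow> y \<in> ball xbar \<delta> \<Longrightarrow> x \<noteq> y \<Longrightarrow> \<bar>q (x, y)\<bar> < e"
          using *[rule_format, of e] by blast
        have "\<bar>F x - F y - v (x - y)\<bar> \<le> e * norm (x - y)"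
          if "x \<in> ball xbar \<delta>" "y \<in> ball xbar \<delta>" for x y
          using \<delta>(2)[OF that] by (cases "x = y") (auto simp: q_def blinfun.zero_right field_simps)
        then show "\<exists>\<delta>>0. \<forall>x\<in>ball xbar \<delta>. \<forall>y\<in>ball xbar \<delta>.
            \<bar>F x - F y - v (x - y)\<bar> \<le> e * norm (x - y)" using \<delta>(1) by blast
      qed
    next
      assume sd: "strict_derivative_at F v xbar"
      show "\<forall>e>0. \<exists>\<delta>>0. \<forall>x\<in>ball xbar \<delta>. \<forall>y\<in>ball xbar \<delta>. x \<noteq> y \<longrightarrow> \<bar>q (x, y)\<bar> < e"
      proof (intro allI impI)
        fix e :: real assume e: "e > 0"
        then have "e / 2 > 0" by simp
        with sd obtain \<delta> where \<delta>: "\<delta> > 0" "\<And>x y. x \<in> ball xbar \<delta> \<Longrightarrow> y \<in> ball xbar \<delta> \<Longrightarrow>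
            \<bar>F x - F y - v (x - y)\<bar> \<le> e / 2 * norm (x - y)"
          unfolding strict_derivative_at_def by blast
        have "\<bar>q (x, y)\<bar> < e" if "x \<in> ball xbar \<delta>" "y \<in> ball xbar \<delta>" "x \<noteq> y" for x y
        proof -
          have "\<bar>q (x, y)\<bar> \<le> e / 2" using \<delta>(2)[OF that(1,2)] that(3) by (simp add: q_def divide_le_eq)
          then show ?thesis using e by simp
        qed
        then show "\<exists>\<delta>>0. \<forall>x\<in>ball xbar \<delta>. \<forall>y\<in>ball xbar \<delta>. x \<noteq> y \<longrightarrow> \<bar>q (x, y)\<bar> < e"
          using \<delta>(1) by blast
      qed
    qed
    finally show ?thesis .
  qed
  then show ?thesis
    unfolding frechet_strictly_differentiable_at_def
    using interior_domain_if_real_near[of r xbar f F, OF r F] by simp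
qed

text \<open>
  From left to right the compact set is the unit ball, and the increment from \<open>y\<close> to \<open>x\<close> is a step of
  length \<open>norm (x - y)\<close> in a unit direction. From right to left a bound on the norms in the compact set
  makes the estimate uniform.
\<close>

lemma hadamard_strictly_differentiable_iff_strict_derivative:
  fixes f :: "'a::real_normed_vector \<Rightarrow> ereal"
  assumes findim: "\<exists>B :: 'a set. finite B \<and> span B = UNIV"
    and r: "r > 0" and F: "\<And>u. u \<in> ball xbar r \<Longrightarrow> f u = ereal (F u)"
  shows "hadamard_strictly_differentiable_at f xbar \<longleftrightarrow> (\<exists>v. strict_derivative_at F v xbar)"
proof
  assume "hadamard_strictly_differentiable_at f xbar"
  then obtain v :: "'a \<Rightarrow>\<^sub>L real" where v: "\<And>K e. compact K \<Longrightarrow> e > 0 \<Longrightarrow>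
        \<forall>\<^sub>F (x, t) in nhds xbar \<times>\<^sub>F at_right (0::real). \<forall>d\<in>K.
           \<bar>(f (x + t *\<^sub>R d) - f x - ereal (t * v d)) / ereal t\<bar> < ereal e"
    unfolding hadamard_strictly_differentiable_at_def by blast
  have compact: "compact (cball (0::'a) 1)"
    by (intro bounded_closed_imp_compact_finite_dim findim bounded_cball closed_cball)
  have "strict_derivative_at F v xbar"
    unfolding strict_derivative_at_def
  proof (intro allI impI)
    fix e :: real assume "e > 0"
    then obtain \<delta> where \<delta>: "\<delta> > 0" "\<And>x t d. x \<in> ball xbar \<delta> \<Longrightarrow> 0 < t \<Longrightarrow> t < \<delta> \<Longrightarrow> norm d = 1 \<Longrightarrow>
        \<bar>(f (x + t *\<^sub>R d) - f x - ereal (t * v d)) / ereal t\<bar> < ereal e"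
      using v[OF compact, of e] unfolding eventually_nhds_at_right_0 by auto
    define \<tau> where "\<tau> = min (\<delta> / 2) r"
    have "\<bar>F x - F y - v (x - y)\<bar> \<le> e * norm (x - y)" if x: "x \<in> ball xbar \<tau>" and y: "y \<in> ball xbar \<tau>" for x y
    proof (cases "x = y")
      case False
      define t where "t = norm (x - y)"
      define d where "d = (x - y) /\<^sub>R t"
      have t: "t > 0" "norm d = 1" "t *\<^sub>R d = x - y" using False by (auto simp: t_def d_def)
      have "t < \<delta>"
        using x y dist_triangle3[of x y xbar] by (simp add: t_def dist_norm \<tau>_def)
      then have "\<bar>(f (y + t *\<^sub>R d) - f y - ereal (t * v d)) / ereal t\<bar> < ereal e"
        using \<delta> y t by (intro \<delta>(2)) (auto simp: \<tau>_def)
      moreover have "t * v d = v (x - y)" using t(3) by (metis blinfun.scaleR_right real_scaleR_def)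
      ultimately have "\<bar>(F x - F y - v (x - y)) / t\<bar> < e"
        using x y t by (simp add: F \<tau>_def)
      then show ?thesis using t(1) by (simp add: t_def[symmetric] divide_less_eq)
    qed (simp add: blinfun.zero_right)
    moreover have "\<tau> > 0" using \<delta>(1) r by (simp add: \<tau>_def)
    ultimately show "\<exists>\<delta>>0. \<forall>x\<in>ball xbar \<delta>. \<forall>y\<in>ball xbar \<delta>. \<bar>F x - F y - v (x - y)\<bar> \<le> e * norm (x - y)"
      by blast
  qed
  then show "\<exists>v. strict_derivative_at F v xbar" ..
next
  assume "\<exists>v. strict_derivative_at F v xbar"
  then obtain v where sd: "strict_derivative_at F v xbar" ..
  have "\<forall>\<^sub>F (x, t) in nhds xbar \<times>\<^sub>F at_right (0::real). \<forall>d\<in>K.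
           \<bar>(f (x + t *\<^sub>R d) - f x - ereal (t * v d)) / ereal t\<bar> < ereal e"
    if "compact K" "e > 0" for K e
  proof -
    obtain M where M: "M > 0" "\<And>d. d \<in> K \<Longrightarrow> norm d \<le> M"
      using compact_imp_bounded[OF \<open>compact K\<close>] by (auto simp: bounded_pos)
    have "e / (2 * M) > 0" using M(1) \<open>e > 0\<close> by simp
    with sd obtain \<delta>0 where \<delta>0: "\<delta>0 > 0" "\<And>x y. x \<in> ball xbar \<delta>0 \<Longrightarrow> y \<in> ball xbar \<delta>0 \<Longrightarrow>
        \<bar>F x - F y - v (x - y)\<bar> \<le> e / (2 * M) * norm (x - y)"
      unfolding strict_derivative_at_def by blast
    define \<delta> where "\<delta> = min \<delta>0 r"
    define \<tau> where "\<tau> = min (\<delta> / 2) (\<delta> / (2 * M))"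
    have \<delta>: "\<delta> > 0" using \<delta>0(1) r by (simp add: \<delta>_def)
    have "\<bar>(f (x + t *\<^sub>R d) - f x - ereal (t * v d)) / ereal t\<bar> < ereal e"
      if x: "x \<in> ball xbar \<tau>" and t: "0 < t" "t < \<tau>" and d: "d \<in> K" for x t d
    proof -
      have "t * norm d \<le> \<tau> * M" using t M d by (intro mult_mono) auto
      also have "\<dots> \<le> \<delta> / (2 * M) * M" using M(1) by (intro mult_right_mono) (auto simp: \<tau>_def)
      also have "\<dots> = \<delta> / 2" using M(1) by simp
      finally have td: "t * norm d \<le> \<delta> / 2" .
      have x': "dist xbar x < \<delta> / 2" using x by (simp add: \<tau>_def)
      have "dist xbar (x + t *\<^sub>R d) \<le> dist xbar x + t * norm d"
        using dist_triangle[of xbar "x + t *\<^sub>R d" x] t by (simp add: dist_norm)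
      then have in_ball: "x + t *\<^sub>R d \<in> ball xbar \<delta>" "x \<in> ball xbar \<delta>"
        using x' td \<delta> by auto
      then have "\<bar>F (x + t *\<^sub>R d) - F x - t * v d\<bar> \<le> e / (2 * M) * (t * norm d)"
        using \<delta>0(2)[of "x + t *\<^sub>R d" x] t by (simp add: \<delta>_def blinfun.scaleR_right)
      also have "\<dots> \<le> e / (2 * M) * (t * M)"
        using M d t \<open>e > 0\<close> by (intro mult_left_mono) auto
      also have "\<dots> = e / 2 * t" using M(1) by simp
      also have "\<dots> < e * t" using \<open>e > 0\<close> t by simp
      finally have "\<bar>(F (x + t *\<^sub>R d) - F x - t * v d) / t\<bar> < e"
        using t by (simp add: divide_less_eq)
      then show ?thesis using in_ball t by (simp add: F \<delta>_def)
    qed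
    moreover have "\<tau> > 0" using \<delta> M(1) by (simp add: \<tau>_def)
    ultimately show ?thesis unfolding eventually_nhds_at_right_0 by blast
  qed
  then show "hadamard_strictly_differentiable_at f xbar"
    unfolding hadamard_strictly_differentiable_at_def
    using interior_domain_if_real_near[of r xbar f F, OF r F] by blast
qed

lemma eps_subdifferential_iff_eps_subgradient:
  fixes f :: "'a::real_normed_vector \<Rightarrow> ereal"
  assumes F: "\<And>u. u \<in> ball xbar r \<Longrightarrow> f u = ereal (F u)" and x: "x \<in> ball xbar r"
  shows "w \<in> eps_subdifferential \<epsilon> f x \<longleftrightarrow> eps_subgradient \<epsilon> F x w"
proof -
  define q where "q u = (F u - F x - w (u - x)) / norm (u - x)" for u
  have near: "\<forall>\<^sub>F u in at x. u \<in> ball xbar r \<and> u \<noteq> x"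
    using x by (intro eventually_conj eventually_at_in_open' eventually_neq_at_within) auto
  have "\<forall>\<^sub>F u in at x. (f u - f x - ereal (w (u - x))) / ereal (norm (u - x)) = ereal (q u)"
    using near by eventually_elim (use x F in \<open>simp add: q_def\<close>)
  then have "Liminf (at x) (\<lambda>u. (f u - f x - ereal (w (u - x))) / ereal (norm (u - x)))
      = Liminf (at x) (\<lambda>u. ereal (q u))" by (rule Liminf_eq)
  moreover have "x \<in> effective_domain f" using F[OF x] by (simp add: effective_domain_def)
  ultimately have "w \<in> eps_subdifferential \<epsilon> f x \<longleftrightarrow> ereal (- \<epsilon>) \<le> Liminf (at x) (\<lambda>u. ereal (q u))"
    by (simp add: eps_subdifferential_def)
  also have "\<dots> \<longleftrightarrow> (\<forall>y<ereal (- \<epsilon>). \<forall>\<^sub>F u in at x. y < ereal (q u))"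
    by (rule le_Liminf_iff)
  also have "\<dots> \<longleftrightarrow> (\<forall>\<eta>>0. \<forall>\<^sub>F u in at x. - (\<epsilon> + \<eta>) \<le> q u)"
  proof (intro iffI allI impI)
    fix \<eta> :: real assume "\<forall>y<ereal (- \<epsilon>). \<forall>\<^sub>F u in at x. y < ereal (q u)" "\<eta> > 0"
    moreover have "ereal (- (\<epsilon> + \<eta>)) < ereal (- \<epsilon>)" using \<open>\<eta> > 0\<close> by simp
    ultimately have "\<forall>\<^sub>F u in at x. ereal (- (\<epsilon> + \<eta>)) < ereal (q u)" by blast
    then show "\<forall>\<^sub>F u in at x. - (\<epsilon> + \<eta>) \<le> q u" by eventually_elim simp
  next
    fix y assume *: "\<forall>\<eta>>0. \<forall>\<^sub>F u in at x. - (\<epsilon> + \<eta>) \<le> q u" and y: "y < ereal (- \<epsilon>)"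
    show "\<forall>\<^sub>F u in at x. y < ereal (q u)"
    proof (cases y)
      case (real c)
      then have "(- \<epsilon> - c) / 2 > 0" using y by simp
      with * have "\<forall>\<^sub>F u in at x. - (\<epsilon> + (- \<epsilon> - c) / 2) \<le> q u" by blast
      then show ?thesis
      proof eventually_elim
        case (elim u)
        then show ?case using real y by (simp add: field_simps)
      qed
    qed (use y in auto)
  qed
  also have "\<dots> \<longleftrightarrow> eps_subgradient \<epsilon> F x w"
  proof -
    have "(\<forall>\<^sub>F u in at x. - (\<epsilon> + \<eta>) \<le> q u) \<longleftrightarrow>
        (\<forall>\<^sub>F u in at x. - (\<epsilon> + \<eta>) * norm (u - x) \<le> F u - F x - w (u - x))" for \<eta>
    proof (rule eventually_cong[OF near])
      fix u assume "u \<in> ball xbar r \<and> u \<noteq> x"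
      then show "(- (\<epsilon> + \<eta>) \<le> q u) \<longleftrightarrow> (- (\<epsilon> + \<eta>) * norm (u - x) \<le> F u - F x - w (u - x))"
        unfolding q_def by (subst pos_le_divide_eq) auto
    qed
    then show ?thesis unfolding eps_subgradient_def by simp
  qed
  finally show ?thesis .
qed

text \<open>
  Along a sequence that defines a limiting subgradient \<open>w\<close>, the distance from \<open>v\<close> is eventually at most
  \<open>\<epsilon> k + e\<close>, for each \<open>e > 0\<close>, so that \<open>w = v\<close>. Constant sequences show that \<open>v\<close> is one.
\<close>

lemma limiting_subdifferential_of_strict_derivative:
  fixes f :: "'a::real_normed_vector \<Rightarrow> ereal"
  assumes r: "r > 0" and F: "\<And>u. u \<in> ball xbar r \<Longrightarrow> f u = ereal (F u)"
    and sd: "strict_derivative_at F v xbar"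
  shows "limiting_subdifferential f xbar = {v}"
proof (intro equalityI subsetI)
  fix w assume "w \<in> limiting_subdifferential f xbar"
  then obtain \<epsilon> x xs where \<epsilon>: "\<And>k. 0 \<le> \<epsilon> k" "\<epsilon> \<longlonglongrightarrow> 0" and x: "x \<longlonglongrightarrow> xbar"
    and xs: "\<And>k. xs k \<in> eps_subdifferential (\<epsilon> k) f (x k)" "xs \<longlonglongrightarrow> w"
    unfolding limiting_subdifferential_def by blast
  have "norm (w - v) \<le> 0"
  proof (rule field_le_epsilon)
    fix e :: real assume "e > 0"
    with sd obtain \<delta> where \<delta>: "\<delta> > 0"
        "\<And>x w \<epsilon>. x \<in> ball xbar \<delta> \<Longrightarrow> \<epsilon> \<ge> 0 \<Longrightarrow> eps_subgradient \<epsilon> F x w \<Longrightarrow> norm (w - v) \<le> \<epsilon> + e"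
      using subgradients_near_strict_derivative by blast
    have "\<forall>\<^sub>F k in sequentially. x k \<in> ball xbar (min r \<delta>)"
      using r \<delta>(1) by (intro topological_tendstoD[OF x]) auto
    then have "\<forall>\<^sub>F k in sequentially. norm (xs k - v) \<le> \<epsilon> k + e"
    proof eventually_elim
      case (elim k)
      then have "eps_subgradient (\<epsilon> k) F (x k) (xs k)"
        using xs(1)[of k] eps_subdifferential_iff_eps_subgradient[of xbar r f F, OF F] by auto
      with elim show ?case by (intro \<delta>(2) \<epsilon>(1)) auto
    qed
    moreover have "(\<lambda>k. norm (xs k - v)) \<longlonglongrightarrow> norm (w - v)" "(\<lambda>k. \<epsilon> k + e) \<longlonglongrightarrow> 0 + e"
      by (intro tendsto_intros xs \<epsilon>)+
    ultimately show "norm (w - v) \<le> 0 + e"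
      by (intro tendsto_le[OF sequentially_bot]) auto
  qed
  then show "w \<in> {v}" by simp
next
  fix w assume "w \<in> {v}"
  then have w: "w = v" by simp
  have "v \<in> eps_subdifferential 0 f xbar"
    using eps_subgradient_of_strict_derivative[OF sd]
      eps_subdifferential_iff_eps_subgradient[of xbar r f F xbar, OF F] r by simp
  then show "w \<in> limiting_subdifferential f xbar"
    unfolding limiting_subdifferential_def w
    by (auto intro!: exI[of _ "\<lambda>_. 0"] exI[of _ "\<lambda>_. xbar"] exI[of _ "\<lambda>_. v"] simp: decseq_def)
qed

text \<open>
  Otherwise there would be subgradients at points tending to \<open>xbar\<close> that stay away from \<open>v\<close>. They
  lie in a compact ball of the dual, and a cluster point would be a second limiting subgradient.
\<close>

lemma subgradients_converge_if_limiting_subdifferential_singleton: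
  fixes f :: "'a::real_normed_vector \<Rightarrow> ereal"
  assumes findim: "\<exists>B :: 'a set. finite B \<and> span B = UNIV"
    and r: "r > 0" and F: "\<And>u. u \<in> ball xbar r \<Longrightarrow> f u = ereal (F u)"
    and "l \<ge> 0"
    and lip: "\<And>x w. x \<in> ball xbar r \<Longrightarrow> w \<in> ball xbar r \<Longrightarrow> \<bar>F x - F w\<bar> \<le> l * norm (x - w)"
    and sub: "limiting_subdifferential f xbar = {v}" and "\<eta> > 0"
  shows "\<exists>\<sigma>>0. \<forall>x\<in>ball xbar \<sigma>. \<forall>w. eps_subgradient 0 F x w \<longrightarrow> norm (w - v) < \<eta>"
proof (rule ccontr)
  assume contra: "\<not> ?thesis"
  have "\<exists>x w. x \<in> ball xbar (min r (1 / Suc n)) \<and> eps_subgradient 0 F x w \<and> \<eta> \<le> norm (w - v)" for n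
  proof -
    have "min r (1 / Suc n) > 0" using r by simp
    with contra show ?thesis by (metis not_less)
  qed
  then obtain x w where x: "\<And>n. x n \<in> ball xbar (min r (1 / Suc n))"
    and w: "\<And>n. eps_subgradient 0 F (x n) (w n)" and far: "\<And>n. \<eta> \<le> norm (w n - v)"
    by metis
  have "(\<lambda>n. dist (x n) xbar) \<longlonglongrightarrow> 0"
  proof (rule tendsto_sandwich[OF _ _ tendsto_const LIMSEQ_inverse_real_of_nat])
    show "\<forall>\<^sub>F n in sequentially. dist (x n) xbar \<le> inverse (real (Suc n))"
      using x by (auto simp: dist_commute inverse_eq_divide less_imp_le)
  qed simp
  then have x_lim: "x \<longlonglongrightarrow> xbar" using tendsto_dist_iff by blast
  have "norm (w n) \<le> l" for n
  proof -
    obtain r' where r': "r' > 0" "ball (x n) r' \<subseteq> ball xbar r"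
      using x[of n] openE[OF open_ball, of "x n" xbar r] by auto
    show ?thesis
      using r' x[of n] by (intro norm_subgradient_le_lipschitz[OF \<open>l \<ge> 0\<close> r'(1) lip w]) auto
  qed
  then have "\<forall>n. w n \<in> cball 0 l" by simp
  moreover have "compact (cball (0 :: 'a \<Rightarrow>\<^sub>L real) l)"
    by (intro bounded_closed_imp_compact_finite_dim finite_dim_dual findim bounded_cball closed_cball)
  ultimately obtain w0 q where q: "strict_mono q" "(w \<circ> q) \<longlonglongrightarrow> w0"
    unfolding compact_eq_seq_compact_metric seq_compact_def by metis
  have xq: "(x \<circ> q) \<longlonglongrightarrow> xbar" using LIMSEQ_subseq_LIMSEQ[OF x_lim q(1)] .
  have "(\<lambda>k. \<bar>F (x (q k)) - F xbar\<bar>) \<longlonglongrightarrow> 0"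
  proof (rule tendsto_sandwich[OF _ _ tendsto_const])
    show "\<forall>\<^sub>F k in sequentially. \<bar>F (x (q k)) - F xbar\<bar> \<le> l * norm (x (q k) - xbar)"
      using x r by (intro always_eventually allI lip) auto
    show "(\<lambda>k. l * norm (x (q k) - xbar)) \<longlonglongrightarrow> 0"
      using xq by (auto intro!: tendsto_eq_intros simp: o_def)
  qed simp
  then have "(\<lambda>k. F (x (q k))) \<longlonglongrightarrow> F xbar"
    by (metis tendsto_rabs_zero_iff LIM_zero_cancel)
  then have "(\<lambda>k. f ((x \<circ> q) k)) \<longlonglongrightarrow> f xbar"
    using x r by (simp add: F)
  moreover have "(w \<circ> q) k \<in> eps_subdifferential 0 f ((x \<circ> q) k)" for k
    using w x[of "q k"] eps_subdifferential_iff_eps_subgradient[of xbar r f F, OF F] by auto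
  ultimately have "w0 \<in> limiting_subdifferential f xbar"
    unfolding limiting_subdifferential_def using q xq
    by (intro CollectI exI[of _ "\<lambda>_. 0"] exI[of _ "x \<circ> q"] exI[of _ "w \<circ> q"])
      (auto simp: decseq_def)
  then have "w0 = v" using sub by simp
  moreover have "(\<lambda>k. norm ((w \<circ> q) k - v)) \<longlonglongrightarrow> norm (w0 - v)"
    by (intro tendsto_intros q)
  then have "\<eta> \<le> norm (w0 - v)"
    by (rule LIMSEQ_le_const) (use far in auto)
  ultimately show False using \<open>\<eta> > 0\<close> by simp
qed

lemma strict_derivative_imp_lipschitz_and_singleton:
  fixes f :: "'a::real_normed_vector \<Rightarrow> ereal"
  assumes r: "r > 0" and F: "\<And>u. u \<in> ball xbar r \<Longrightarrow> f u = ereal (F u)"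
    and sd: "strict_derivative_at F v xbar"
  shows "locally_lipschitz_at f xbar" "is_singleton (limiting_subdifferential f xbar)"
proof -
  obtain l \<delta> where l: "l \<ge> 0" "\<delta> > 0"
      "\<And>x w. x \<in> ball xbar \<delta> \<Longrightarrow> w \<in> ball xbar \<delta> \<Longrightarrow> \<bar>F x - F w\<bar> \<le> l * norm (x - w)"
    using strict_derivative_imp_lipschitz[OF sd] by blast
  define \<tau> where "\<tau> = min \<delta> r / 2"
  have \<tau>: "\<tau> > 0" "\<tau> < \<delta>" "\<tau> < r" using l(2) r by (auto simp: \<tau>_def)
  have "\<bar>f x - f w\<bar> \<le> ereal (l * norm (x - w))" if "x \<in> cball xbar \<tau>" "w \<in> cball xbar \<tau>" for x w
    using that \<tau> l(3)[of x w] by (simp add: F)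
  then show "locally_lipschitz_at f xbar"
    unfolding locally_lipschitz_at_def using l(1) \<tau>(1) by blast
  show "is_singleton (limiting_subdifferential f xbar)"
    using limiting_subdifferential_of_strict_derivative[OF r F sd] by simp
qed

lemma strict_derivative_if_lipschitz_and_singleton:
  fixes f :: "'a::real_normed_vector \<Rightarrow> ereal"
  assumes findim: "\<exists>B :: 'a set. finite B \<and> span B = UNIV"
    and r: "r > 0" and F: "\<And>u. u \<in> ball xbar r \<Longrightarrow> f u = ereal (F u)"
    and ll: "locally_lipschitz_at f xbar"
    and sub: "limiting_subdifferential f xbar = {v}"
  shows "strict_derivative_at F v xbar"
proof -
  obtain l \<delta> where l: "l \<ge> 0" "\<delta> > 0" "\<And>x w. x \<in> cball xbar \<delta> \<Longrightarrow> w \<in> cball xbar \<delta> \<Longrightarrow>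
      \<bar>f x - f w\<bar> \<le> ereal (l * norm (x - w))"
    using ll unfolding locally_lipschitz_at_def by blast
  define \<tau> where "\<tau> = min \<delta> r"
  have \<tau>: "\<tau> > 0" using l(2) r by (simp add: \<tau>_def)
  have F': "\<And>u. u \<in> ball xbar \<tau> \<Longrightarrow> f u = ereal (F u)" using F by (simp add: \<tau>_def)
  have lip: "\<bar>F x - F w\<bar> \<le> l * norm (x - w)" if "x \<in> ball xbar \<tau>" "w \<in> ball xbar \<tau>" for x w
    using l(3)[of x w] that F by (simp add: \<tau>_def)
  show ?thesis
    by (rule strict_derivative_if_subgradients_converge[OF findim l(1) \<tau> lip])
      (assumption | rule subgradients_converge_if_limiting_subdifferential_singleton
        [OF findim \<tau> F' l(1) lip sub])+
qed

text \<open>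
  The strict derivative at \<open>y\<close> is a subgradient at \<open>y\<close>, hence close to the strict derivative at \<open>x\<close>
  when \<open>y\<close> is close to \<open>x\<close>.
\<close>

lemma continuously_differentiable_on_if_strict_derivatives:
  fixes f :: "'a::real_normed_vector \<Rightarrow> ereal"
  assumes fin: "\<And>x. x \<in> D \<Longrightarrow> \<bar>f x\<bar> \<noteq> \<infinity>"
    and sd: "\<And>x. x \<in> D \<Longrightarrow> \<exists>v. strict_derivative_at (\<lambda>u. real_of_ereal (f u)) v x"
  shows "continuously_differentiable_on f D"
proof -
  define F where "F u = real_of_ereal (f u)" for u
  obtain f' where f': "\<And>x. x \<in> D \<Longrightarrow> strict_derivative_at F (f' x) x"
    using sd unfolding F_def by metis
  have "continuous_on D f'"
    unfolding continuous_on_iff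
  proof (intro ballI allI impI)
    fix x and e :: real assume x: "x \<in> D" and "e > 0"
    then have "e / 2 > 0" by simp
    then obtain \<delta> where \<delta>: "\<delta> > 0" "\<And>y w \<epsilon>. y \<in> ball x \<delta> \<Longrightarrow> \<epsilon> \<ge> 0 \<Longrightarrow>
        eps_subgradient \<epsilon> F y w \<Longrightarrow> norm (w - f' x) \<le> \<epsilon> + e / 2"
      using subgradients_near_strict_derivative[OF f'[OF x]] by blast
    have "dist (f' y) (f' x) < e" if "y \<in> D" "dist y x < \<delta>" for y
      using \<delta>(2)[of y 0 "f' y"] eps_subgradient_of_strict_derivative[OF f'[OF that(1)]] that(2) \<open>e > 0\<close>
      by (simp add: dist_norm norm_minus_commute)
    then show "\<exists>d>0. \<forall>y\<in>D. dist y x < d \<longrightarrow> dist (f' y) (f' x) < e" using \<delta>(1) by blast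
  qed
  then show ?thesis
    unfolding continuously_differentiable_on_def
    using fin strict_derivative_imp_has_derivative[OF f'] by (auto simp: F_def[abs_def])
qed

theorem corollary6p2:
  fixes f :: "'a::real_normed_vector \<Rightarrow> ereal" and xbar :: 'a
  assumes findim: "\<exists>B :: 'a set. finite B \<and> span B = UNIV"
    and proper: "\<And>x. f x \<noteq> -\<infinity>"
    and int_dom: "xbar \<in> interior (effective_domain f)"
  shows "(hadamard_strictly_differentiable_at f xbar \<longleftrightarrow> frechet_strictly_differentiable_at f xbar) \<and>
         (frechet_strictly_differentiable_at f xbar \<longleftrightarrow>
            locally_lipschitz_at f xbar \<and> is_singleton (limiting_subdifferential f xbar)) \<and>
         (\<forall>D. open D \<and> (\<forall>x\<in>D. hadamard_strictly_differentiable_at f x) \<longrightarrow>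
            continuously_differentiable_on f D) \<and>
         (\<forall>D. open D \<and> (\<forall>x\<in>D. frechet_strictly_differentiable_at f x) \<longrightarrow>
            continuously_differentiable_on f D)"
proof -
  let ?F = "\<lambda>u. real_of_ereal (f u)"
  have hadamard: "hadamard_strictly_differentiable_at f x \<longleftrightarrow> (\<exists>v. strict_derivative_at ?F v x)"
    and frechet: "frechet_strictly_differentiable_at f x \<longleftrightarrow> (\<exists>v. strict_derivative_at ?F v x)"
    and lipschitz: "(\<exists>v. strict_derivative_at ?F v x) \<longleftrightarrow>
      locally_lipschitz_at f x \<and> is_singleton (limiting_subdifferential f x)"
    if x: "x \<in> interior (effective_domain f)" for x
  proof -
    obtain r where r: "r > 0" "\<And>u. u \<in> ball x r \<Longrightarrow> f u = ereal (?F u)"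
      using interior_domain_real_near[OF proper x] by blast
    show "hadamard_strictly_differentiable_at f x \<longleftrightarrow> (\<exists>v. strict_derivative_at ?F v x)"
      by (rule hadamard_strictly_differentiable_iff_strict_derivative[OF findim r])
    show "frechet_strictly_differentiable_at f x \<longleftrightarrow> (\<exists>v. strict_derivative_at ?F v x)"
      by (rule frechet_strictly_differentiable_iff_strict_derivative[OF r])
    show "(\<exists>v. strict_derivative_at ?F v x) \<longleftrightarrow>
        locally_lipschitz_at f x \<and> is_singleton (limiting_subdifferential f x)"
    proof
      assume "\<exists>v. strict_derivative_at ?F v x"
      then obtain v where "strict_derivative_at ?F v x" ..
      from strict_derivative_imp_lipschitz_and_singleton[OF r this]
      show "locally_lipschitz_at f x \<and> is_singleton (limiting_subdifferential f x)" by (rule conjI)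
    next
      assume *: "locally_lipschitz_at f x \<and> is_singleton (limiting_subdifferential f x)"
      then obtain v where "limiting_subdifferential f x = {v}" by (auto elim: is_singletonE)
      from strict_derivative_if_lipschitz_and_singleton[OF findim r _ this] *
      show "\<exists>v. strict_derivative_at ?F v x" by blast
    qed
  qed
  have C1: "continuously_differentiable_on f D"
    if "\<forall>x\<in>D. x \<in> interior (effective_domain f)" "\<forall>x\<in>D. \<exists>v. strict_derivative_at ?F v x" for D
  proof (rule continuously_differentiable_on_if_strict_derivatives)
    fix x assume "x \<in> D"
    then have "x \<in> effective_domain f" using that(1) interior_subset by blast
    then show "\<bar>f x\<bar> \<noteq> \<infinity>" using proper[of x] by (auto simp: effective_domain_def)
  qed (use that(2) in blast)
  have interior: "hadamard_strictly_differentiable_at f x \<Longrightarrow> x \<in> interior (effective_domain f)"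
    "frechet_strictly_differentiable_at f x \<Longrightarrow> x \<in> interior (effective_domain f)" for x
    by (simp_all add: hadamard_strictly_differentiable_at_def frechet_strictly_differentiable_at_def)
  have "continuously_differentiable_on f D"
    if "\<forall>x\<in>D. hadamard_strictly_differentiable_at f x" for D
    using that by (intro C1 ballI interior(1) hadamard[OF interior(1), THEN iffD1]) auto
  moreover have "continuously_differentiable_on f D"
    if "\<forall>x\<in>D. frechet_strictly_differentiable_at f x" for D
    using that by (intro C1 ballI interior(2) frechet[OF interior(2), THEN iffD1]) auto
  ultimately show ?thesis
    unfolding hadamard[OF int_dom] frechet[OF int_dom] lipschitz[OF int_dom] by simp
qed

end
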